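(* Let $q$ be a complex number with $|q|<1$. Then the following two identities hold: \begin{align*} \sum_{i,j,k\ge 0}\frac{q^{\frac{1}{2}i^2+4j^2+k^2+ij+2jk+\frac{1}{2}i+k}}{(q;q)_i(q;q)_j(q^2;q^2)_k} &=\frac{(q^8,q^{12},q^{20};q^{20})_\infty}{(q;q)_\infty},\\ \sum_{i,j,k\ge 0}\frac{q^{\frac{1}{2}i^2+4j^2+k^2+ij+2jk+\frac{1}{2}i+4j+k}}{(q;q)_i(q;q)_j(q^2;q^2)_k} &=\frac{(q^4,q^{16},q^{20};q^{20})_\infty}{(q;q)_\infty}. \end{align*}
   Context: For $|q|<1$: $(a;q)_\infty=\prod_{m=0}^\infty(1-aq^m)$, $(a;q)_n=(a;q)_\infty/(aq^n;q)_\infty=\prod_{m=0}^{n-1}(1-aq^m)$ for integers $n\ge0$, and $(a_1,\dots,a_r;q)_\infty=(a_1;q)_\infty\cdots(a_r;q)_\infty$; the same notation is used with the base $q$ replaced by a power of $q$. All exponents of $q$ in the sums are integers. *)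

theory Defs
  imports "HOL-Analysis.Analysis"
begin

definition qpoch :: "complex \<Rightarrow> complex \<Rightarrow> nat \<Rightarrow> complex" where
  "qpoch a q n = (\<Prod>m<n. 1 - a * q ^ m)"

text \<open>
  The product converges for \<open>norm q < 1\<close>; \<^const>\<open>prodinf\<close> admits
  finitely many zero factors, in which case its value is zero.
\<close>

definition qpoch_inf :: "complex \<Rightarrow> complex \<Rightarrow> complex" where
  "qpoch_inf a q = (\<Prod>m. 1 - a * q ^ m)"

definition qpoch_inf_list :: "complex list \<Rightarrow> complex \<Rightarrow> complex" where
  "qpoch_inf_list as q = (\<Prod>a\<leftarrow>as. qpoch_inf a q)"

end

theory Submission
  imports Defs
begin

text \<open>
  In both triple sums the indices \<open>i\<close> and \<open>k\<close> interact only with \<open>j\<close>. For fixed \<open>j\<close> the sums over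
  \<open>i\<close> and over \<open>k\<close> are therefore two independent instances of Euler's expansion of an infinite
  product (\<open>euler_sums\<close>), with values \<open>(-q^(j+1); q)\<^sub>\<infinity>\<close> and \<open>(-q^(2j+2); q\<^sup>2)\<^sub>\<infinity>\<close>. These are \<open>(-q; q)\<^sub>\<infinity>\<close>
  and \<open>(-q\<^sup>2; q\<^sup>2)\<^sub>\<infinity>\<close> without their first \<open>j\<close> factors, and \<open>(a; q)\<^sub>n (-a; q)\<^sub>n = (a\<^sup>2; q\<^sup>2)\<^sub>n\<close>, for finite and for
  infinite \<open>n\<close>, merges everything into base \<open>q^4\<close>: the triple sum equals
  \<open>(q^4; q^4)\<^sub>\<infinity> / (q; q)\<^sub>\<infinity>\<close> times the sum over \<open>j\<close> of \<open>q^(4 j\<^sup>2) / (q^4; q^4)\<^sub>j\<close>, with an additional \<open>4 j\<close> in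
  the exponent for the second identity (\<open>triple_sum_eq_single_sum\<close>). This is a Rogers--Ramanujan
  sum in \<open>q^4\<close>, and the denominator \<open>(q^4; q^4)\<^sub>\<infinity>\<close> of its product side cancels.

  The Rogers--Ramanujan identities are proved by Bailey's method, with all the algebra done on finite
  sums. A Bailey pair relative to \<open>a\<close> is a pair of sequences linked by a triangular system of
  equations. Cauchy's finite summation (\<open>cauchy_sum\<close>) shows that multiplying \<open>\<alpha> k\<close> by \<open>a^k q^(k\<^sup>2)\<close>
  yields a new Bailey pair (\<open>bailey_lemma\<close>). Two such steps from the pair whose \<open>\<beta>\<close> is
  \<open>1, 0, 0, ...\<close> (\<open>unit_bailey_pair\<close>) give a finite form of the identity for each \<open>n\<close>; dominated
  convergence as \<open>n\<close> tends to infinity turns it into \<open>rogers_ramanujan_parameter\<close>, which expands the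
  Rogers--Ramanujan series, with a free parameter \<open>a\<close>, as a series of theta type. For \<open>a = 1\<close> and
  \<open>a = q\<close> the latter is summed by the Jacobi triple product in base \<open>q^5\<close>.

  Both Euler's expansion and the triple product are limits of the finite \<open>q\<close>-binomial theorem, again by
  dominated convergence.
\<close>

section \<open>Finite and infinite q-Pochhammer symbols\<close>

lemma qpoch_0 [simp]: "qpoch a q 0 = 1"
  by (simp add: qpoch_def)

lemma qpoch_Suc: "qpoch a q (Suc n) = qpoch a q n * (1 - a * q ^ n)"
  by (simp add: qpoch_def)

lemma qpoch_add: "qpoch a q (m + n) = qpoch a q m * qpoch (a * q ^ m) q n"
  by (induction n) (simp_all add: qpoch_Suc power_add mult.assoc)

lemma qpoch_Suc_left: "qpoch a q (Suc n) = (1 - a) * qpoch (a * q) q n"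
  using qpoch_add[of a q 1 n] by (simp add: qpoch_Suc)

lemma norm_mult_less_1:
  fixes a q :: complex
  assumes "norm a \<le> 1" "norm q < 1"
  shows "norm (a * q) < 1"
  using assms mult_right_mono[of "norm a" 1 "norm q"] by (simp add: norm_mult)

lemma norm_mult_power_less_1:
  fixes a q :: complex
  assumes "norm a < 1" "norm q < 1"
  shows "norm (a * q ^ n) < 1"
proof -
  have "norm q ^ n \<le> 1"
    using assms by (intro power_le_one) auto
  then have "norm a * norm q ^ n \<le> norm a * 1"
    by (intro mult_left_mono) auto
  then show ?thesis
    using assms by (simp add: norm_mult norm_power)
qed

lemma one_minus_mult_power_nonzero:
  fixes a q :: complex
  assumes "norm a < 1" "norm q < 1"
  shows "1 - a * q ^ n \<noteq> 0"
  using norm_mult_power_less_1[OF assms, of n] by auto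

lemma qpoch_nonzero:
  assumes "norm a < 1" "norm q < 1"
  shows "qpoch a q n \<noteq> 0"
  unfolding qpoch_def using one_minus_mult_power_nonzero[OF assms] by simp

lemma qpoch_self_nonzero: "norm q < 1 \<Longrightarrow> qpoch q q n \<noteq> 0"
  by (rule qpoch_nonzero)

lemma qpoch_mult_neg: "qpoch a q n * qpoch (- a) q n = qpoch (a\<^sup>2) (q\<^sup>2) n"
  by (induction n)
    (simp_all add: qpoch_Suc algebra_simps power_mult_distrib power2_eq_square
      flip: power_mult_distrib)

lemma convergent_prod_qpoch:
  fixes a q :: complex
  assumes "norm q < 1"
  shows "convergent_prod (\<lambda>m. 1 - a * q ^ m)"
proof -
  have "summable (\<lambda>m. norm (1 - a * q ^ m - 1))"
    using assms by (simp add: norm_mult norm_power summable_mult summable_geometric)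
  then show ?thesis
    by (intro abs_convergent_prod_imp_convergent_prod summable_imp_abs_convergent_prod)
qed

lemma qpoch_tendsto_inf:
  assumes "norm q < 1"
  shows "(\<lambda>n. qpoch a q n) \<longlonglongrightarrow> qpoch_inf a q"
  using convergent_prod_LIMSEQ[OF convergent_prod_qpoch[OF assms, of a]]
  unfolding qpoch_def qpoch_inf_def by (simp add: LIMSEQ_lessThan_iff_atMost)

lemma qpoch_inf_nonzero:
  assumes "norm a < 1" "norm q < 1"
  shows "qpoch_inf a q \<noteq> 0"
  unfolding qpoch_inf_def
  using prodinf_nonzero[OF convergent_prod_qpoch[OF assms(2)]] one_minus_mult_power_nonzero[OF assms]
  by blast

lemma qpoch_inf_split:
  assumes "norm q < 1"
  shows "qpoch_inf a q = qpoch a q n * qpoch_inf (a * q ^ n) q"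
proof (rule LIMSEQ_unique)
  show "(\<lambda>m. qpoch a q (n + m)) \<longlonglongrightarrow> qpoch_inf a q"
    using LIMSEQ_ignore_initial_segment[OF qpoch_tendsto_inf[OF assms, of a], of n]
    by (simp add: add.commute)
  show "(\<lambda>m. qpoch a q (n + m)) \<longlonglongrightarrow> qpoch a q n * qpoch_inf (a * q ^ n) q"
    unfolding qpoch_add by (intro tendsto_intros qpoch_tendsto_inf assms)
qed

lemma qpoch_inf_mult_neg:
  assumes "norm q < 1"
  shows "qpoch_inf a q * qpoch_inf (- a) q = qpoch_inf (a\<^sup>2) (q\<^sup>2)"
proof (rule LIMSEQ_unique)
  show "(\<lambda>n. qpoch a q n * qpoch (- a) q n) \<longlonglongrightarrow> qpoch_inf a q * qpoch_inf (- a) q"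
    by (intro tendsto_intros qpoch_tendsto_inf assms)
  show "(\<lambda>n. qpoch a q n * qpoch (- a) q n) \<longlonglongrightarrow> qpoch_inf (a\<^sup>2) (q\<^sup>2)"
    unfolding qpoch_mult_neg using assms
    by (intro qpoch_tendsto_inf) (simp add: norm_power power_less_one_iff)
qed

text \<open>
  Convergence to a nonzero limit bounds the reciprocals uniformly, as dominated convergence requires.
\<close>

lemma inverse_qpoch_bounded:
  assumes "norm a < 1" "norm q < 1"
  obtains M where "M \<ge> 0" "\<And>n. norm (inverse (qpoch a q n)) \<le> M"
proof -
  have "(\<lambda>n. inverse (qpoch a q n)) \<longlonglongrightarrow> inverse (qpoch_inf a q)"
    using assms by (intro tendsto_inverse qpoch_tendsto_inf qpoch_inf_nonzero)
  then have "Bseq (\<lambda>n. inverse (qpoch a q n))"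
    by (intro convergent_imp_Bseq) (auto simp: convergent_def)
  then obtain M where "M > 0" "\<And>n. norm (inverse (qpoch a q n)) \<le> M"
    unfolding Bseq_def by blast
  then show ?thesis
    using that[of M] by simp
qed

lemma qpoch_bounded:
  assumes "norm q < 1"
  obtains M where "M \<ge> 0" "\<And>n. norm (qpoch a q n) \<le> M"
proof -
  have "Bseq (\<lambda>n. qpoch a q n)"
    using qpoch_tendsto_inf[OF assms] by (intro convergent_imp_Bseq) (auto simp: convergent_def)
  then obtain M where "M > 0" "\<And>n. norm (qpoch a q n) \<le> M"
    unfolding Bseq_def by blast
  then show ?thesis
    using that[of M] by simp
qed

lemma inverse_qpoch_tendsto:
  assumes "norm a < 1" "norm q < 1" "filterlim g at_top sequentially"
  shows "(\<lambda>n. inverse (qpoch a q (g n))) \<longlonglongrightarrow> inverse (qpoch_inf a q)"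
  using assms
  by (intro tendsto_inverse qpoch_inf_nonzero filterlim_compose[OF qpoch_tendsto_inf])

text \<open>
  Dominated convergence in the form needed to pass from a finite identity to an infinite one: the
  weights \<open>c n k\<close> only have to be controlled on the triangle \<open>k \<le> n\<close>, which is what reciprocals of
  \<open>qpoch q q (n - k)\<close> allow.
\<close>

lemma tendsto_sum_atMost_tannery:
  fixes b :: "nat \<Rightarrow> complex" and c :: "nat \<Rightarrow> nat \<Rightarrow> complex"
  assumes "summable (\<lambda>k. norm (b k))" "\<And>k. (\<lambda>n. c n k) \<longlonglongrightarrow> L"
    "\<And>n k. k \<le> n \<Longrightarrow> norm (c n k) \<le> M"
  shows "(\<lambda>n. \<Sum>k\<le>n. b k * c n k) \<longlonglongrightarrow> (\<Sum>k. b k) * L"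
proof -
  define f where "f k n = (if k \<le> n then b k * c n k else 0)" for k n
  have "M \<ge> 0"
    using assms(3)[of 0 0] norm_ge_zero order_trans by blast
  have "(\<lambda>n. \<Sum>k. f k n) \<longlonglongrightarrow> (\<Sum>k. b k * L)"
  proof (rule tannerys_theorem[THEN conjunct2, THEN conjunct2])
    show "(\<lambda>n. f k n) \<longlonglongrightarrow> b k * L" for k
    proof (rule Lim_transform_eventually)
      show "(\<lambda>n. b k * c n k) \<longlonglongrightarrow> b k * L"
        by (intro tendsto_intros assms)
      show "\<forall>\<^sub>F n in sequentially. b k * c n k = f k n"
        using eventually_ge_at_top[of k] by eventually_elim (simp add: f_def)
    qed
    have "norm (f k n) \<le> norm (b k) * M" for k n
      using assms(3) \<open>M \<ge> 0\<close> by (auto simp: f_def norm_mult intro: mult_left_mono)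
    then show "\<forall>\<^sub>F (k, n) in at_top \<times>\<^sub>F sequentially. norm (f k n) \<le> norm (b k) * M"
      by (intro always_eventually) auto
    show "summable (\<lambda>k. norm (b k) * M)"
      using assms(1) by (rule summable_mult2)
  qed simp
  moreover have "(\<Sum>k. f k n) = (\<Sum>k\<le>n. b k * c n k)" for n
    by (subst suminf_finite[of "{..n}"]) (auto simp: f_def)
  moreover have "(\<Sum>k. b k * L) = (\<Sum>k. b k) * L"
    by (rule suminf_mult2[symmetric, OF summable_norm_cancel[OF assms(1)]])
  ultimately show ?thesis
    by simp
qed

lemma filterlim_minus_const_nat: "filterlim (\<lambda>n::nat. n - k) at_top sequentially"
  by (rule filterlim_at_top_mono[OF _ eventuallyI, of "\<lambda>n. n - k"])
    (auto simp: filterlim_at_top eventually_at_top_linorder intro: le_diff_conv2[THEN iffD2]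
      intro!: exI[of _ "_ + k"])

section \<open>The q-binomial theorem and Euler's expansion\<close>

text \<open>
  Gaussian binomial coefficients. The recursion, rather than a quotient of Pochhammer symbols, makes
  them vanish for \<open>k > n\<close>, so that sums can be shifted without boundary cases.
\<close>

fun qbinom :: "complex \<Rightarrow> nat \<Rightarrow> nat \<Rightarrow> complex" where
  "qbinom q n 0 = 1"
| "qbinom q 0 (Suc k) = 0"
| "qbinom q (Suc n) (Suc k) = q ^ Suc k * qbinom q n (Suc k) + qbinom q n k"

lemma qbinom_eq_0: "n < k \<Longrightarrow> qbinom q n k = 0"
  by (induction q n k rule: qbinom.induct) auto

lemma qbinom_self [simp]: "qbinom q n n = 1"
  by (induction n) (simp_all add: qbinom_eq_0)

lemma qbinom_add_mult_qpoch: "qbinom q (k + m) k * (qpoch q q k * qpoch q q m) = qpoch q q (k + m)"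
proof (induction "k + m" arbitrary: k m)
  case 0
  then show ?case by simp
next
  case (Suc n)
  show ?case
  proof (cases "k = 0 \<or> m = 0")
    case True
    then show ?thesis by auto
  next
    case False
    then obtain k' m' where [simp]: "k = Suc k'" "m = Suc m'"
      by (meson not0_implies_Suc)
    have IH1: "qbinom q (Suc (k' + m')) (Suc k') * (qpoch q q (Suc k') * qpoch q q m')
        = qpoch q q (Suc (k' + m'))"
      using Suc(1)[of "Suc k'" m'] Suc(2) by simp
    have IH2: "qbinom q (Suc (k' + m')) k' * (qpoch q q k' * qpoch q q (Suc m'))
        = qpoch q q (Suc (k' + m'))"
      using Suc(1)[of k' "Suc m'"] Suc(2) by simp
    have "qbinom q (k + m) k * (qpoch q q k * qpoch q q m) =
       q ^ Suc k' * (1 - q ^ Suc m') *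
         (qbinom q (Suc (k' + m')) (Suc k') * (qpoch q q (Suc k') * qpoch q q m'))
       + (1 - q ^ Suc k') * (qbinom q (Suc (k' + m')) k' * (qpoch q q k' * qpoch q q (Suc m')))"
      by (simp add: qpoch_Suc) algebra
    also have "\<dots> = (1 - q ^ (Suc (Suc (k' + m')))) * qpoch q q (Suc (k' + m'))"
      unfolding IH1 IH2 by (simp add: algebra_simps power_add)
    also have "\<dots> = qpoch q q (k + m)"
      by (simp add: qpoch_Suc)
    finally show ?thesis .
  qed
qed

lemma qbinom_eq_divide:
  assumes "norm q < 1" "k \<le> n"
  shows "qbinom q n k = qpoch q q n / (qpoch q q k * qpoch q q (n - k))"
  using qbinom_add_mult_qpoch[of q k "n - k"] qpoch_self_nonzero[OF assms(1)] assms(2)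
  by (simp add: field_simps)

text \<open>
  Pascal's rule in summed form: raising \<open>n\<close> by one acts on the summand \<open>A\<close> as a linear operator. Both
  the \<open>q\<close>-binomial theorem and Cauchy's summation follow by induction from this single step.
\<close>

lemma sum_qbinom_Suc:
  "(\<Sum>k\<le>Suc n. A k * qbinom q (Suc n) k)
     = (\<Sum>k\<le>n. (q ^ k * A k + A (Suc k)) * qbinom q n k)"
proof -
  have "(\<Sum>k\<le>n. q ^ k * A k * qbinom q n k) = (\<Sum>k\<le>Suc n. q ^ k * A k * qbinom q n k)"
    by (simp add: qbinom_eq_0)
  also have "\<dots> = A 0 + (\<Sum>k\<le>n. q ^ Suc k * A (Suc k) * qbinom q n (Suc k))"
    by (subst sum.atMost_Suc_shift) simp
  finally have "(\<Sum>k\<le>n. q ^ k * A k * qbinom q n k)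
      = A 0 + (\<Sum>k\<le>n. q ^ Suc k * A (Suc k) * qbinom q n (Suc k))" .
  moreover have "(\<Sum>k\<le>Suc n. A k * qbinom q (Suc n) k) =
      A 0 + (\<Sum>k\<le>n. q ^ Suc k * A (Suc k) * qbinom q n (Suc k)) + (\<Sum>k\<le>n. A (Suc k) * qbinom q n k)"
    by (subst sum.atMost_Suc_shift) (simp add: algebra_simps sum.distrib)
  ultimately show ?thesis
    by (simp add: algebra_simps sum.distrib)
qed

text \<open>
  The coefficients of the \<open>q\<close>-binomial theorem; the same sequence supplies the theta series of the
  triple product and the unit Bailey pair.
\<close>

definition signed_tri :: "complex \<Rightarrow> nat \<Rightarrow> complex" where
  "signed_tri q k = (-1) ^ k * q ^ (k choose 2)"

lemma Suc_choose_two: "Suc k choose 2 = (k choose 2) + k"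
  by (simp add: numeral_2_eq_2)

lemma signed_tri_0 [simp]: "signed_tri q 0 = 1"
  by (simp add: signed_tri_def numeral_2_eq_2)

lemma signed_tri_Suc: "signed_tri q (Suc k) = - (q ^ k) * signed_tri q k"
  by (simp add: signed_tri_def Suc_choose_two power_add)

theorem q_binomial_theorem:
  "qpoch z q n = (\<Sum>k\<le>n. signed_tri q k * z ^ k * qbinom q n k)"
proof (induction n arbitrary: z)
  case 0
  then show ?case by simp
next
  case (Suc n)
  have "qpoch z q (Suc n) = (1 - z) * (\<Sum>k\<le>n. signed_tri q k * (z * q) ^ k * qbinom q n k)"
    by (simp add: qpoch_Suc_left Suc)
  also have "\<dots> = (\<Sum>k\<le>n. (q ^ k * (signed_tri q k * z ^ k)
      + signed_tri q (Suc k) * z ^ Suc k) * qbinom q n k)"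
    by (simp add: sum_distrib_left signed_tri_Suc algebra_simps power_mult_distrib)
  finally show ?case
    by (simp only: sum_qbinom_Suc)
qed

text \<open>
  The ratio of consecutive terms is \<open>-p\<^sup>k z\<close>, so the series converges for every \<open>z\<close>, however large.
\<close>

lemma summable_norm_signed_tri_power:
  fixes p z :: complex
  assumes "norm p < 1"
  shows "summable (\<lambda>k. norm (signed_tri p k * z ^ k))"
proof -
  have "(\<lambda>k. norm p ^ k * norm z) \<longlonglongrightarrow> 0 * norm z"
    using assms by (intro tendsto_intros LIMSEQ_power_zero) auto
  then have "\<forall>\<^sub>F k in sequentially. norm p ^ k * norm z < 1 / 2"
    by (intro order_tendstoD) auto
  then obtain N where N: "\<And>k. k \<ge> N \<Longrightarrow> norm p ^ k * norm z < 1 / 2"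
    by (auto simp: eventually_at_top_linorder)
  show ?thesis
  proof (rule summable_ratio_test[of "1 / 2" N])
    fix k assume "N \<le> k"
    have "norm (signed_tri p (Suc k) * z ^ Suc k)
        = (norm p ^ k * norm z) * norm (signed_tri p k * z ^ k)"
      by (simp add: signed_tri_Suc norm_mult norm_power)
    also have "\<dots> \<le> 1 / 2 * norm (signed_tri p k * z ^ k)"
      using N[OF \<open>N \<le> k\<close>] by (intro mult_right_mono) auto
    finally show "norm (norm (signed_tri p (Suc k) * z ^ Suc k))
        \<le> 1 / 2 * norm (norm (signed_tri p k * z ^ k))"
      by simp
  qed simp
qed

lemma summable_norm_euler:
  assumes "norm q < 1"
  shows "summable (\<lambda>k. norm (signed_tri q k * z ^ k / qpoch q q k))"
proof -
  obtain M where M: "M \<ge> 0" "\<And>n. norm (inverse (qpoch q q n)) \<le> M"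
    using inverse_qpoch_bounded[OF assms assms] by blast
  show ?thesis
  proof (rule summable_comparison_test'[of "\<lambda>k. norm (signed_tri q k * z ^ k) * M"])
    show "summable (\<lambda>k. norm (signed_tri q k * z ^ k) * M)"
      by (intro summable_mult2 summable_norm_signed_tri_power assms)
    show "norm (norm (signed_tri q k * z ^ k / qpoch q q k)) \<le> norm (signed_tri q k * z ^ k) * M"
      for k
      using mult_left_mono[OF M(2)[of k] norm_ge_zero[of "signed_tri q k * z ^ k"]]
      by (simp add: norm_mult norm_divide norm_inverse divide_inverse)
  qed
qed

text \<open>
  After division by \<open>qpoch q q n\<close> the terms of the \<open>q\<close>-binomial theorem depend on \<open>n\<close> only through
  \<open>qpoch q q (n - k)\<close>, and letting \<open>n\<close> tend to infinity gives Euler's expansion.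
\<close>

theorem euler_sums:
  assumes "norm q < 1"
  shows "(\<lambda>k. signed_tri q k * z ^ k / qpoch q q k) sums qpoch_inf z q"
proof -
  define b where "b k = signed_tri q k * z ^ k / qpoch q q k" for k
  note b_summable = summable_norm_euler[OF assms, of z, folded b_def]
  obtain M where M: "M \<ge> 0" "\<And>n. norm (inverse (qpoch q q n)) \<le> M"
    using inverse_qpoch_bounded[OF assms assms] by blast
  have finite_identity: "(\<Sum>k\<le>n. b k * inverse (qpoch q q (n - k))) = qpoch z q n * inverse (qpoch q q n)" for n
    unfolding q_binomial_theorem[of z q n] sum_distrib_right b_def
    using qpoch_self_nonzero[OF assms]
    by (intro sum.cong) (simp_all add: qbinom_eq_divide[OF assms] field_simps)
  have "(\<lambda>n. qpoch z q n * inverse (qpoch q q n)) \<longlonglongrightarrow> qpoch_inf z q * inverse (qpoch_inf q q)"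
    by (intro tendsto_mult qpoch_tendsto_inf tendsto_inverse qpoch_inf_nonzero assms)
  moreover have "(\<lambda>n. \<Sum>k\<le>n. b k * inverse (qpoch q q (n - k)))
      \<longlonglongrightarrow> (\<Sum>k. b k) * inverse (qpoch_inf q q)"
    by (rule tendsto_sum_atMost_tannery[OF b_summable _ M(2)])
      (intro inverse_qpoch_tendsto filterlim_minus_const_nat assms)
  ultimately have "qpoch_inf z q * inverse (qpoch_inf q q) = (\<Sum>k. b k) * inverse (qpoch_inf q q)"
    unfolding finite_identity by (rule LIMSEQ_unique)
  then have "(\<Sum>k. b k) = qpoch_inf z q"
    using qpoch_inf_nonzero[OF assms assms] by simp
  then show ?thesis
    using summable_sums[OF summable_norm_cancel[OF b_summable]] by (simp add: b_def)
qed

section \<open>The Jacobi triple product\<close>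

lemma signed_tri_add: "signed_tri p (m + k) = signed_tri p m * signed_tri p k * p ^ (m * k)"
  by (induction k) (simp_all add: signed_tri_Suc power_add mult_ac)

lemma signed_tri_square: "signed_tri p (Suc k) * signed_tri p (Suc k) = p ^ (k * Suc k)"
  by (induction k) (simp_all add: signed_tri_Suc power_add mult_ac)

text \<open>
  The hypothesis makes \<open>x p\<^sup>m\<close> and \<open>w p^(n-m)\<close> reciprocal, so taking \<open>-x p\<^sup>m\<close> out of each factor turns
  the product into the one for \<open>w\<close> read backwards.
\<close>

lemma qpoch_reverse:
  assumes "x * w * p ^ n = 1"
  shows "qpoch x p (Suc n) = signed_tri p (Suc n) * x ^ Suc n * qpoch w p (Suc n)"
proof -
  have flip: "1 - x * p ^ m = - (x * p ^ m) * (1 - w * p ^ (Suc n - Suc m))" if "m < Suc n" for m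
  proof -
    have "p ^ n = p ^ m * p ^ (Suc n - Suc m)"
      using that by (simp flip: power_add)
    then show ?thesis
      using assms by (simp add: algebra_simps)
  qed
  have monomials: "(\<Prod>m<N. - (x * p ^ m)) = signed_tri p N * x ^ N" for N
    by (induction N) (simp_all add: signed_tri_Suc mult_ac)
  have "qpoch x p (Suc n) = (\<Prod>m<Suc n. - (x * p ^ m)) * (\<Prod>m<Suc n. 1 - w * p ^ (Suc n - Suc m))"
    unfolding qpoch_def prod.distrib[symmetric] by (rule prod.cong[OF refl flip]) simp
  also have "(\<Prod>m<Suc n. 1 - w * p ^ (Suc n - Suc m)) = qpoch w p (Suc n)"
    unfolding qpoch_def by (rule prod.nat_diff_reindex)
  finally show ?thesis
    by (simp only: monomials)
qed

lemma sum_split_middle: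
  fixes f :: "nat \<Rightarrow> 'a :: comm_monoid_add"
  shows "(\<Sum>j\<le>2 * n + 1. f j) = (\<Sum>k\<le>n. f (n + 1 + k)) + (\<Sum>k\<le>n. f (n - k))"
proof -
  have "(\<Sum>j\<le>2 * n + 1. f j) = (\<Sum>j\<in>{n+1..2*n+1}. f j) + (\<Sum>j\<le>n. f j)"
  proof -
    have "{..2 * n + 1} = {n + 1..2 * n + 1} \<union> {..n}"
      by auto
    then show ?thesis
      by (simp only:) (rule sum.union_disjoint; auto)
  qed
  moreover have "(\<Sum>j\<in>{n+1..2*n+1}. f j) = (\<Sum>k\<le>n. f (n + 1 + k))"
    by (rule sum.reindex_bij_witness[of _ "\<lambda>k. n + 1 + k" "\<lambda>j. j - (n + 1)"]) auto
  moreover have "(\<Sum>j\<le>n. f j) = (\<Sum>k\<le>n. f (n - k))"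
    by (rule sum.reindex_bij_witness[of _ "\<lambda>k. n - k" "\<lambda>j. n - j"]) auto
  ultimately show ?thesis
    by simp
qed

text \<open>
  The \<open>q\<close>-binomial theorem with \<open>2n + 1\<close> factors, started at \<open>x = z / p^(n+1)\<close>: the last \<open>n\<close> factors form
  the symbol of \<open>z\<close>, the first \<open>n + 1\<close> reverse to the symbol of \<open>w\<close>. Reading the sum outwards from
  its middle pairs the power \<open>z\<^sup>k\<close> with \<open>w^(k+1)\<close>; the odd number of factors gives both the
  same Gaussian binomial.
\<close>

lemma finite_jacobi_triple_product:
  assumes "norm p < 1" "p \<noteq> 0" "z * w = p"
  shows "qpoch z p n * qpoch w p (Suc n) = qpoch p p (2 * n + 1) *
    (\<Sum>k\<le>n. (signed_tri p k * z ^ k + signed_tri p (Suc k) * w ^ Suc k)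
       * (inverse (qpoch p p (n - k)) * inverse (qpoch p p (n + 1 + k))))"
proof -
  define x where "x = z / p ^ Suc n"
  define C where "C = signed_tri p (Suc n) * x ^ Suc n"
  have "z \<noteq> 0"
    using assms by auto
  then have "C \<noteq> 0"
    using assms by (simp add: C_def x_def signed_tri_def)
  have xz: "x * p ^ Suc n = z"
    using assms by (simp add: x_def)
  have xw: "x * w * p ^ n = 1"
    using assms by (simp add: x_def field_simps)
  define f where "f j = signed_tri p j * x ^ j * qbinom p (2 * n + 1) j" for j
  define c where "c k = inverse (qpoch p p (n - k)) * inverse (qpoch p p (n + 1 + k))" for k
  have upper: "f (n + 1 + k) = C * (qpoch p p (2 * n + 1) * (signed_tri p k * z ^ k * c k))"
    if "k \<le> n" for k
  proof -
    have "2 * n + 1 - (n + 1 + k) = n - k"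
      using that by simp
    then have "qbinom p (2 * n + 1) (n + 1 + k) = qpoch p p (2 * n + 1) * c k"
      using that by (subst qbinom_eq_divide[OF assms(1)]) (auto simp: c_def divide_inverse mult_ac)
    moreover have "signed_tri p (n + 1 + k) * x ^ (n + 1 + k) = C * (signed_tri p k * z ^ k)"
    proof -
      have "z ^ k = x ^ k * p ^ (Suc n * k)"
        by (simp only: xz[symmetric] power_mult_distrib power_mult)
      moreover have "n + 1 + k = Suc n + k"
        by simp
      ultimately show ?thesis
        by (simp only: C_def signed_tri_add power_add mult_ac)
    qed
    ultimately show ?thesis
      by (simp add: f_def mult_ac)
  qed
  have lower: "f (n - k) = C * (qpoch p p (2 * n + 1) * (signed_tri p (Suc k) * w ^ Suc k * c k))"
    if "k \<le> n" for k
  proof -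
    define m where "m = n - k"
    have n: "n = m + k"
      using that by (simp add: m_def)
    have "2 * n + 1 - (n - k) = n + 1 + k"
      using that by simp
    then have binom: "qbinom p (2 * n + 1) (n - k) = qpoch p p (2 * n + 1) * c k"
      using that by (subst qbinom_eq_divide[OF assms(1)]) (auto simp: c_def divide_inverse mult_ac)
    have "C * (signed_tri p (Suc k) * w ^ Suc k)
        = signed_tri p m * x ^ m * ((signed_tri p (Suc k) * signed_tri p (Suc k))
            * p ^ (m * Suc k) * (x * w) ^ Suc k)"
      using signed_tri_add[of p m "Suc k"]
      by (simp add: C_def n power_add power_mult_distrib mult_ac)
    also have "\<dots> = signed_tri p m * x ^ m * (x * w * p ^ n) ^ Suc k"
    proof -
      have "n * Suc k = k * Suc k + m * Suc k"
        by (simp add: n algebra_simps)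
      then have "(p ^ n) ^ Suc k = p ^ (k * Suc k) * p ^ (m * Suc k)"
        by (simp only: power_mult[symmetric] power_add)
      then show ?thesis
        unfolding signed_tri_square power_mult_distrib[of "x * w"] by (simp only: mult_ac)
    qed
    also have "\<dots> = signed_tri p (n - k) * x ^ (n - k)"
      unfolding xw by (simp add: n)
    finally have rewritten: "C * (signed_tri p (Suc k) * w ^ Suc k) = signed_tri p (n - k) * x ^ (n - k)" .
    show ?thesis
      unfolding f_def binom rewritten[symmetric] by (simp only: mult_ac)
  qed
  have "C * (qpoch z p n * qpoch w p (Suc n)) = qpoch x p (Suc n + n)"
    unfolding qpoch_add qpoch_reverse[OF xw] xz C_def by (simp add: mult_ac)
  also have "\<dots> = (\<Sum>j\<le>2 * n + 1. f j)"
    unfolding q_binomial_theorem f_def by (simp add: mult_2)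
  also have "\<dots> = C * (qpoch p p (2 * n + 1) *
      (\<Sum>k\<le>n. (signed_tri p k * z ^ k + signed_tri p (Suc k) * w ^ Suc k) * c k))"
    unfolding sum_split_middle sum_distrib_left sum.distrib[symmetric]
    by (intro sum.cong refl) (simp only: atMost_iff upper lower distrib_left distrib_right)
  finally show ?thesis
    using \<open>C \<noteq> 0\<close> by (simp add: c_def)
qed

text \<open>
  The bilateral theta series, folded: since \<open>w = p / z\<close>, the terms with \<open>w^(k+1)\<close> are those of index
  \<open>-(k + 1)\<close> in \<open>z\<close>. Writing them with \<open>w\<close> avoids negative powers and keeps \<open>p = 0\<close> admissible.
\<close>

theorem jacobi_triple_product:
  assumes "norm p < 1" "z * w = p"
  shows "(\<lambda>k. signed_tri p k * z ^ k + signed_tri p (Suc k) * w ^ Suc k) sums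
    (qpoch_inf z p * qpoch_inf w p * qpoch_inf p p)"
proof (cases "p = 0")
  case True
  \<comment> \<open>Here one of \<open>z\<close> and \<open>w\<close> vanishes, so the reduction to \<open>z / p^(n+1)\<close> is not available.\<close>
  have inf: "qpoch_inf y 0 = 1 - y" for y
    using prodinf_finite[of "{0}" "\<lambda>m. 1 - y * 0 ^ m"] by (auto simp: qpoch_inf_def power_0_left)
  have "(\<lambda>k. signed_tri p k * z ^ k + signed_tri p (Suc k) * w ^ Suc k) sums
      (\<Sum>k\<in>{0,1}. signed_tri p k * z ^ k + signed_tri p (Suc k) * w ^ Suc k)"
  proof (rule sums_finite)
    show "signed_tri p k * z ^ k + signed_tri p (Suc k) * w ^ Suc k = 0" if "k \<notin> {0, 1}" for k
    proof -
      have "2 \<le> k"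
        using that by (simp add: less_2_cases_iff flip: not_less)
      then obtain l where "k = 2 + l"
        using le_Suc_ex by blast
      then have "k = Suc (Suc l)"
        by simp
      then show ?thesis
        by (simp add: True signed_tri_Suc)
    qed
  qed simp
  also have "(\<Sum>k\<in>{0,1}. signed_tri p k * z ^ k + signed_tri p (Suc k) * w ^ Suc k) = (1 - z) * (1 - w)"
    using assms True by (auto simp: signed_tri_Suc algebra_simps)
  finally show ?thesis
    by (simp add: True inf)
next
  case False
  obtain M where M: "M \<ge> 0" "\<And>n. norm (inverse (qpoch p p n)) \<le> M"
    using inverse_qpoch_bounded[OF assms(1) assms(1)] by blast
  define b where "b k = signed_tri p k * z ^ k + signed_tri p (Suc k) * w ^ Suc k" for k
  have b_summable: "summable (\<lambda>k. norm (b k))"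
  proof (rule summable_comparison_test')
    show "summable (\<lambda>k. norm (signed_tri p k * z ^ k) + norm (signed_tri p (Suc k) * w ^ Suc k))"
      by (rule summable_add[OF summable_norm_signed_tri_power[OF assms(1)]
            summable_Suc_iff[THEN iffD2, OF summable_norm_signed_tri_power[OF assms(1)]]])
    show "norm (norm (b k)) \<le> norm (signed_tri p k * z ^ k) + norm (signed_tri p (Suc k) * w ^ Suc k)"
      for k
      using norm_triangle_ineq by (simp add: b_def del: power_Suc)
  qed
  define c where "c n k = inverse (qpoch p p (n - k)) * inverse (qpoch p p (n + 1 + k))" for n k
  have "(\<lambda>n. \<Sum>k\<le>n. b k * c n k) \<longlonglongrightarrow> (\<Sum>k. b k) * (inverse (qpoch_inf p p) * inverse (qpoch_inf p p))"
  proof (rule tendsto_sum_atMost_tannery[OF b_summable])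
    show "(\<lambda>n. c n k) \<longlonglongrightarrow> inverse (qpoch_inf p p) * inverse (qpoch_inf p p)" for k
      unfolding c_def add.assoc
      by (intro tendsto_mult inverse_qpoch_tendsto filterlim_minus_const_nat
          filterlim_add_const_nat_at_top assms)
    show "norm (c n k) \<le> M * M" for n k
      unfolding c_def norm_mult using M by (intro mult_mono) auto
  qed
  moreover have "filterlim (\<lambda>n::nat. 2 * n + 1) at_top sequentially"
    by (rule filterlim_subseq) (simp add: strict_mono_def)
  ultimately have "(\<lambda>n. qpoch p p (2 * n + 1) * (\<Sum>k\<le>n. b k * c n k))
      \<longlonglongrightarrow> qpoch_inf p p * ((\<Sum>k. b k) * (inverse (qpoch_inf p p) * inverse (qpoch_inf p p)))"
    by (intro tendsto_mult filterlim_compose[OF qpoch_tendsto_inf] assms)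
  moreover have finite_identity:
    "qpoch p p (2 * n + 1) * (\<Sum>k\<le>n. b k * c n k) = qpoch z p n * qpoch w p (Suc n)" for n
    using finite_jacobi_triple_product[OF assms(1) False assms(2), of n] by (simp only: b_def c_def)
  moreover have "(\<lambda>n. qpoch z p n * qpoch w p (Suc n)) \<longlonglongrightarrow> qpoch_inf z p * qpoch_inf w p"
    by (intro tendsto_mult qpoch_tendsto_inf LIMSEQ_Suc assms)
  ultimately have "qpoch_inf p p * ((\<Sum>k. b k) * (inverse (qpoch_inf p p) * inverse (qpoch_inf p p)))
      = qpoch_inf z p * qpoch_inf w p"
    unfolding finite_identity by (auto intro: LIMSEQ_unique)
  then have "(\<Sum>k. b k) = qpoch_inf z p * qpoch_inf w p * qpoch_inf p p"
    using qpoch_inf_nonzero[OF assms(1,1)] by (simp add: field_simps)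
  then show ?thesis
    using summable_sums[OF summable_norm_cancel[OF b_summable]] by (simp add: b_def)
qed

section \<open>Bailey pairs\<close>

text \<open>
  Cauchy's summation, cleared of denominators. By Pascal's rule the sum for \<open>n + 1\<close> at \<open>x\<close> equals
  the sum for \<open>n\<close> at \<open>x q\<close>: the two contributions to the term with index \<open>s\<close> are
  \<open>1 - y\<close> times and \<open>y\<close> times the new term, where \<open>y = x q^(s+1)\<close>.
\<close>

lemma sum_qbinom_cauchy:
  "(\<Sum>s\<le>n. x ^ s * q ^ s\<^sup>2 * qpoch (x * q ^ Suc s) q (n - s) * qbinom q n s) = 1"
proof (induction n arbitrary: x)
  case 0
  then show ?case by simp
next
  case (Suc n)
  have step: "q ^ s * (x ^ s * q ^ s\<^sup>2 * qpoch (x * q ^ Suc s) q (Suc n - s))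
      + x ^ Suc s * q ^ (Suc s)\<^sup>2 * qpoch (x * q ^ Suc (Suc s)) q (Suc n - Suc s)
      = (x * q) ^ s * q ^ s\<^sup>2 * qpoch (x * q * q ^ Suc s) q (n - s)" if "s \<le> n" for s
  proof -
    have e1: "qpoch (x * q ^ Suc s) q (Suc n - s)
        = (1 - x * q ^ Suc s) * qpoch (x * q * q ^ Suc s) q (n - s)"
      using that by (simp add: Suc_diff_le qpoch_Suc_left mult_ac)
    have e2: "q ^ (Suc s)\<^sup>2 = q ^ s\<^sup>2 * q ^ s * q ^ Suc s"
      by (simp add: power2_eq_square power_add mult_ac)
    have e3: "qpoch (x * q ^ Suc (Suc s)) q (Suc n - Suc s) = qpoch (x * q * q ^ Suc s) q (n - s)"
      by (simp add: mult_ac)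
    show ?thesis
      unfolding e1 e2 e3 by (simp add: algebra_simps power_mult_distrib)
  qed
  have "(\<Sum>s\<le>Suc n. x ^ s * q ^ s\<^sup>2 * qpoch (x * q ^ Suc s) q (Suc n - s) * qbinom q (Suc n) s)
      = (\<Sum>s\<le>n. (x * q) ^ s * q ^ s\<^sup>2 * qpoch (x * q * q ^ Suc s) q (n - s) * qbinom q n s)"
    unfolding sum_qbinom_Suc by (intro sum.cong refl arg_cong2[of _ _ _ _ "(*)"] step) auto
  then show ?case
    by (simp only: Suc)
qed

lemma cauchy_sum:
  assumes "norm q < 1" "norm x \<le> 1"
  shows "(\<Sum>s\<le>n. x ^ s * q ^ s\<^sup>2 / (qpoch q q (n - s) * qpoch q q s * qpoch (x * q) q s))
    = 1 / (qpoch q q n * qpoch (x * q) q n)"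
proof -
  note xq = norm_mult_less_1[OF assms(2,1)]
  note nz = qpoch_self_nonzero[OF assms(1)] qpoch_nonzero[OF xq assms(1)]
  have "x ^ s * q ^ s\<^sup>2 / (qpoch q q (n - s) * qpoch q q s * qpoch (x * q) q s)
      = x ^ s * q ^ s\<^sup>2 * qpoch (x * q ^ Suc s) q (n - s) * qbinom q n s
         / (qpoch q q n * qpoch (x * q) q n)" if "s \<le> n" for s
  proof -
    have "qpoch (x * q) q n = qpoch (x * q) q s * qpoch (x * q ^ Suc s) q (n - s)"
      using qpoch_add[of "x * q" q s "n - s"] that by (simp add: mult_ac)
    moreover from this have "qpoch (x * q ^ Suc s) q (n - s) \<noteq> 0"
      using nz by force
    ultimately show ?thesis
      using nz that by (simp add: qbinom_eq_divide[OF assms(1)] field_simps del: power_Suc)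
  qed
  then show ?thesis
    using sum_qbinom_cauchy[of x q n] by (simp flip: sum_divide_distrib)
qed

definition bailey_pair ::
  "complex \<Rightarrow> complex \<Rightarrow> (nat \<Rightarrow> complex) \<Rightarrow> (nat \<Rightarrow> complex) \<Rightarrow> bool" where
  "bailey_pair a q \<alpha> \<beta> \<longleftrightarrow>
     (\<forall>n. \<beta> n = (\<Sum>k\<le>n. \<alpha> k / (qpoch q q (n - k) * qpoch (a * q) q (n + k))))"

lemma sum_triangle_shift:
  fixes g :: "nat \<Rightarrow> nat \<Rightarrow> 'a :: comm_monoid_add"
  shows "(\<Sum>r\<le>n. \<Sum>k\<le>r. g r k) = (\<Sum>k\<le>n. \<Sum>s\<le>n - k. g (k + s) k)"
  unfolding sum.Sigma[OF finite_atMost ballI[OF finite_atMost]]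
  by (rule sum.reindex_bij_witness[where i = "\<lambda>(k, s). (k + s, k)" and j = "\<lambda>(r, k). (k, r - k)"])
    auto

text \<open>
  After exchanging the two summations and writing \<open>r = k + s\<close>, the inner sum over \<open>s\<close> is Cauchy's
  summation at \<open>x = a q^(2k)\<close> with upper limit \<open>n - k\<close>.
\<close>

theorem bailey_lemma:
  assumes "norm q < 1" "norm a \<le> 1" "bailey_pair a q \<alpha> \<beta>"
  shows "bailey_pair a q (\<lambda>k. a ^ k * q ^ k\<^sup>2 * \<alpha> k)
    (\<lambda>n. \<Sum>r\<le>n. a ^ r * q ^ r\<^sup>2 * \<beta> r / qpoch q q (n - r))"
  unfolding bailey_pair_def
proof
  fix n
  have \<beta>: "\<beta> r = (\<Sum>k\<le>r. \<alpha> k / (qpoch q q (r - k) * qpoch (a * q) q (r + k)))" for r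
    using assms(3) by (simp add: bailey_pair_def)
  have inner: "(\<Sum>s\<le>n - k. a ^ (k + s) * q ^ (k + s)\<^sup>2
        * (\<alpha> k / (qpoch q q (k + s - k) * qpoch (a * q) q (k + s + k))) / qpoch q q (n - (k + s)))
      = a ^ k * q ^ k\<^sup>2 * \<alpha> k / (qpoch q q (n - k) * qpoch (a * q) q (n + k))"
    if "k \<le> n" for k
  proof -
    define x where "x = a * q ^ (2 * k)"
    have x: "norm x \<le> 1"
      using assms(1,2) unfolding x_def norm_mult norm_power
      by (intro mult_le_one power_le_one zero_le_power) auto
    have shift: "qpoch (a * q) q (2 * k + m) = qpoch (a * q) q (2 * k) * qpoch (x * q) q m" for m
      by (simp add: qpoch_add x_def mult_ac)
    have "a ^ (k + s) * q ^ (k + s)\<^sup>2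
        * (\<alpha> k / (qpoch q q (k + s - k) * qpoch (a * q) q (k + s + k))) / qpoch q q (n - (k + s))
        = a ^ k * q ^ k\<^sup>2 * \<alpha> k / qpoch (a * q) q (2 * k)
          * (x ^ s * q ^ s\<^sup>2 / (qpoch q q (n - k - s) * qpoch q q s * qpoch (x * q) q s))" for s
    proof -
      have "a ^ (k + s) * q ^ (k + s)\<^sup>2 = a ^ k * q ^ k\<^sup>2 * (x ^ s * q ^ s\<^sup>2)"
        by (simp add: x_def power2_sum power_add power_mult_distrib mult_ac flip: power_mult)
      moreover have "qpoch (a * q) q (k + s + k) = qpoch (a * q) q (2 * k) * qpoch (x * q) q s"
        using shift[of s] by (simp add: mult_2 add_ac)
      ultimately show ?thesis
        by (simp add: mult_ac)
    qed
    then have "(\<Sum>s\<le>n - k. a ^ (k + s) * q ^ (k + s)\<^sup>2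
        * (\<alpha> k / (qpoch q q (k + s - k) * qpoch (a * q) q (k + s + k))) / qpoch q q (n - (k + s)))
        = a ^ k * q ^ k\<^sup>2 * \<alpha> k / qpoch (a * q) q (2 * k)
          * (1 / (qpoch q q (n - k) * qpoch (x * q) q (n - k)))"
      by (simp only: cauchy_sum[OF assms(1) x] flip: sum_distrib_left)
    also have "qpoch (a * q) q (n + k) = qpoch (a * q) q (2 * k) * qpoch (x * q) q (n - k)"
      using shift[of "n - k"] that by (simp add: mult_2 add.commute)
    then have "a ^ k * q ^ k\<^sup>2 * \<alpha> k / qpoch (a * q) q (2 * k)
          * (1 / (qpoch q q (n - k) * qpoch (x * q) q (n - k)))
        = a ^ k * q ^ k\<^sup>2 * \<alpha> k / (qpoch q q (n - k) * qpoch (a * q) q (n + k))"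
      by simp
    finally show ?thesis .
  qed
  show "(\<Sum>r\<le>n. a ^ r * q ^ r\<^sup>2 * \<beta> r / qpoch q q (n - r))
      = (\<Sum>k\<le>n. a ^ k * q ^ k\<^sup>2 * \<alpha> k / (qpoch q q (n - k) * qpoch (a * q) q (n + k)))"
    unfolding \<beta> sum_distrib_left sum_divide_distrib sum_triangle_shift
    by (intro sum.cong refl inner) auto
qed

text \<open>
  The classical formula has \<open>(a; q)\<^sub>k / (1 - a)\<close> in place of \<open>(aq; q)\<^sub>k\<^sub>-\<^sub>1\<close>. Cancelling the factor \<open>1 - a\<close>
  makes \<open>a = 1\<close> a regular value, at the price of a separate clause for \<open>k = 0\<close>.
\<close>

definition unit_alpha :: "complex \<Rightarrow> complex \<Rightarrow> nat \<Rightarrow> complex" where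
  "unit_alpha a q k = (if k = 0 then 1
     else (1 - a * q ^ (2 * k)) * qpoch (a * q) q (k - 1) / qpoch q q k * signed_tri q k)"

text \<open>
  A limiting case of the classical indefinite summation of a very-well-poised series; the closed form
  is what makes the full sum for \<open>n > 0\<close> computable.
\<close>

lemma unit_alpha_partial_sum:
  assumes "norm q < 1" "norm a \<le> 1" "K < n"
  shows "(\<Sum>k\<le>K. unit_alpha a q k / (qpoch q q (n - k) * qpoch (a * q) q (n + k)))
    = qpoch (a * q) q K * signed_tri q K * q ^ K
      / (qpoch q q K * (1 - q ^ n) * qpoch q q (n - Suc K) * qpoch (a * q) q (n + K))"
  using assms(3)
proof (induction K)
  case 0
  then obtain m where "n = Suc m"
    by (cases n) auto
  then show ?case
    by (simp add: unit_alpha_def qpoch_Suc mult_ac)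
next
  case (Suc K)
  then obtain m where n: "n = Suc (Suc (K + m))"
    by (metis add_Suc less_iff_Suc_add)
  define u v where "u = q ^ K" and "v = q ^ m"
  define P R D E S where "P = qpoch (a * q) q K" and "R = qpoch q q K" and "D = qpoch q q m"
    and "E = qpoch (a * q) q (n + K)" and "S = signed_tri q K"
  define W X Y Z where "W = 1 - u * v * q\<^sup>2" and "X = 1 - v * q" and "Y = 1 - u * q"
    and "Z = 1 - a * q * (u\<^sup>2 * v * q\<^sup>2)"
  note nz = one_minus_mult_power_nonzero[OF norm_mult_less_1[OF assms(2,1)] assms(1)]
    one_minus_mult_power_nonzero[OF assms(1) assms(1)]
  have ne: "W \<noteq> 0" "X \<noteq> 0" "Y \<noteq> 0" "Z \<noteq> 0"
    using nz(2)[of "Suc (K + m)"] nz(2)[of m] nz(2)[of K] nz(1)[of "n + K"]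
    by (simp_all add: W_def X_def Y_def Z_def u_def v_def n power_add power2_eq_square mult_ac)
  \<comment> \<open>The polynomial identity behind the induction step; here \<open>q ^ n = u * v * q\<^sup>2\<close>.\<close>
  have key: "Y * Z - (1 - a * (u * q)\<^sup>2) * W = - (u * q * (1 - a * q * u) * X)"
    unfolding W_def X_def Y_def Z_def by algebra
  have qn: "q ^ n = u * v * q\<^sup>2"
    by (simp add: n u_def v_def power_add power2_eq_square mult_ac)
  have "unit_alpha a q (Suc K) / (qpoch q q (n - Suc K) * qpoch (a * q) q (n + Suc K))
      = - ((1 - a * (u * q)\<^sup>2) * P * u * S) / (R * Y * D * X * E * Z)"
  proof -
    have "n - Suc K = Suc m"
      by (simp add: n)
    moreover have "qpoch (a * q) q (n + Suc K) = E * Z"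
      using qpoch_Suc[of "a * q" q "n + K"]
      by (simp add: E_def Z_def power_add qn power2_eq_square mult_ac u_def)
    moreover have "q ^ (2 * Suc K) = (u * q)\<^sup>2"
      by (simp only: power_even_eq u_def power_Suc2)
    ultimately show ?thesis
      by (simp add: unit_alpha_def qpoch_Suc signed_tri_Suc P_def R_def D_def S_def X_def Y_def
          u_def v_def mult_ac)
  qed
  moreover have "qpoch (a * q) q K * signed_tri q K * q ^ K
      / (qpoch q q K * (1 - q ^ n) * qpoch q q (n - Suc K) * qpoch (a * q) q (n + K))
      = P * S * u / (R * W * D * X * E)"
    by (simp add: n P_def S_def u_def R_def W_def D_def X_def E_def v_def qpoch_Suc power_add
        power2_eq_square mult_ac)
  moreover have "qpoch (a * q) q (Suc K) * signed_tri q (Suc K) * q ^ Suc K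
      / (qpoch q q (Suc K) * (1 - q ^ n) * qpoch q q (n - Suc (Suc K)) * qpoch (a * q) q (n + Suc K))
      = - (P * (1 - a * q * u) * u * S * u * q) / (R * Y * W * D * E * Z)"
  proof -
    have "qpoch (a * q) q (n + Suc K) = E * Z"
      using qpoch_Suc[of "a * q" q "n + K"]
      by (simp add: E_def Z_def power_add qn power2_eq_square mult_ac u_def)
    moreover have "n - Suc (Suc K) = m"
      by (simp add: n)
    ultimately show ?thesis
      by (simp add: qn qpoch_Suc signed_tri_Suc P_def R_def D_def S_def Y_def W_def u_def mult_ac)
  qed
  moreover have "P * S * u / (R * W * D * X * E)
      + - ((1 - a * (u * q)\<^sup>2) * P * u * S) / (R * Y * D * X * E * Z)
      = P * S * u * (Y * Z - (1 - a * (u * q)\<^sup>2) * W) / (R * W * D * X * E * Y * Z)"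
    using ne by (simp add: divide_simps) (simp add: algebra_simps)
  moreover have "\<dots> = - (P * (1 - a * q * u) * u * S * u * q) / (R * Y * W * D * E * Z)"
    unfolding key using ne by (simp add: mult_ac)
  ultimately show ?case
    using Suc by simp
qed

text \<open>
  For \<open>n > 0\<close> the closed partial sum up to \<open>n - 1\<close> is the negative of the last term.
\<close>

theorem unit_bailey_pair:
  assumes "norm q < 1" "norm a \<le> 1"
  shows "bailey_pair a q (unit_alpha a q) (\<lambda>n. if n = 0 then 1 else 0)"
  unfolding bailey_pair_def
proof
  fix n
  show "(if n = 0 then 1 else 0)
      = (\<Sum>k\<le>n. unit_alpha a q k / (qpoch q q (n - k) * qpoch (a * q) q (n + k)))"
  proof (cases n)
    case 0
    then show ?thesis by (simp add: unit_alpha_def)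
  next
    case (Suc m)
    define c where "c = a * q * q ^ (n + m)"
    have "1 - c \<noteq> 0"
      unfolding c_def by (intro one_minus_mult_power_nonzero norm_mult_less_1 assms)
    moreover have "qpoch (a * q) q (n + n) = qpoch (a * q) q (n + m) * (1 - c)"
      by (simp add: Suc qpoch_Suc c_def)
    moreover have "a * q ^ (2 * n) = c"
      by (simp add: Suc c_def mult_2)
    moreover have "n \<noteq> 0" "n - 1 = m" "n - Suc m = 0" "n - n = 0"
        "qpoch q q n = qpoch q q m * (1 - q ^ n)" "signed_tri q n = - (q ^ m * signed_tri q m)"
      by (simp_all add: Suc qpoch_Suc signed_tri_Suc)
    ultimately have "unit_alpha a q n / (qpoch q q (n - n) * qpoch (a * q) q (n + n))
      = - (qpoch (a * q) q m * signed_tri q m * q ^ m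
      / (qpoch q q m * (1 - q ^ n) * qpoch q q (n - Suc m) * qpoch (a * q) q (n + m)))"
      by (simp add: unit_alpha_def mult_ac)
    then show ?thesis
      using unit_alpha_partial_sum[OF assms, of m n] by (simp add: Suc)
  qed
qed

section \<open>The Rogers--Ramanujan identities\<close>

lemma summable_norm_mult_power_square:
  fixes q :: complex
  assumes "norm q < 1" "\<And>k. norm (b k) \<le> M"
  shows "summable (\<lambda>k. norm (b k * q ^ k\<^sup>2))"
proof (rule summable_comparison_test'[of "\<lambda>k. M * norm q ^ k"])
  show "summable (\<lambda>k. M * norm q ^ k)"
    using assms by (intro summable_mult summable_geometric) auto
  have "0 \<le> M"
    using order_trans[OF norm_ge_zero assms(2)[of 0]] .
  fix k :: nat
  have "norm q ^ k\<^sup>2 \<le> norm q ^ k"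
    using assms(1) by (intro power_decreasing) (auto simp: power2_eq_square)
  then show "norm (norm (b k * q ^ k\<^sup>2)) \<le> M * norm q ^ k"
    using assms(2)[of k] \<open>0 \<le> M\<close> by (auto simp: norm_mult norm_power intro!: mult_mono)
qed

lemma unit_alpha_bounded:
  assumes "norm q < 1" "norm a \<le> 1"
  obtains M where "\<And>k. norm (unit_alpha a q k) \<le> M"
proof -
  obtain B1 where B1: "B1 \<ge> 0" "\<And>n. norm (qpoch (a * q) q n) \<le> B1"
    using qpoch_bounded[OF assms(1)] by blast
  obtain B2 where B2: "B2 \<ge> 0" "\<And>n. norm (inverse (qpoch q q n)) \<le> B2"
    using inverse_qpoch_bounded[OF assms(1,1)] by blast
  have "norm (unit_alpha a q k) \<le> max 1 (2 * B1 * B2 * 1)" for k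
  proof (cases "k = 0")
    case True
    then show ?thesis by (simp add: unit_alpha_def)
  next
    case False
    have "norm (a * q ^ (2 * k)) \<le> 1"
      unfolding norm_mult norm_power using assms by (intro mult_le_one power_le_one) auto
    then have 1: "norm (1 - a * q ^ (2 * k)) \<le> 2"
      using norm_triangle_ineq4[of 1 "a * q ^ (2 * k)"] by simp
    have 2: "norm (signed_tri q k) \<le> 1"
      using assms by (simp add: signed_tri_def norm_mult norm_power power_le_one)
    have "norm (unit_alpha a q k) = norm (1 - a * q ^ (2 * k)) * norm (qpoch (a * q) q (k - 1))
        * norm (inverse (qpoch q q k)) * norm (signed_tri q k)"
      using False by (simp add: unit_alpha_def norm_mult norm_divide norm_inverse divide_inverse)
    also have "\<dots> \<le> 2 * B1 * B2 * 1"
      using 1 2 B1 B2 by (intro mult_mono) auto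
    finally show ?thesis by simp
  qed
  then show ?thesis
    using that by blast
qed

text \<open>
  The Bailey lemma applied twice to the unit pair: the first step turns the sequence \<open>1, 0, 0, ...\<close> into
  \<open>1 / (q; q)\<^sub>n\<close>, the second into the sum of the terms of the Rogers--Ramanujan series up to \<open>n\<close>, weighted
  by reciprocals of \<open>qpoch q q (n - r)\<close>. On both sides these reciprocals tend to \<open>1 / (q; q)\<^sub>\<infinity>\<close>,
  which cancels in the limit.
\<close>

theorem rogers_ramanujan_parameter:
  assumes "norm q < 1" "norm a \<le> 1"
  shows "(\<lambda>n. a ^ n * q ^ n\<^sup>2 / qpoch q q n) sums
    ((\<Sum>k. unit_alpha a q k * a ^ (2 * k) * q ^ (2 * k\<^sup>2)) / qpoch_inf (a * q) q)"
proof -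
  note aq = norm_mult_less_1[OF assms(2,1)]
  obtain B1 where B1: "B1 \<ge> 0" "\<And>n. norm (inverse (qpoch (a * q) q n)) \<le> B1"
    using inverse_qpoch_bounded[OF aq assms(1)] by blast
  obtain B2 where B2: "B2 \<ge> 0" "\<And>n. norm (inverse (qpoch q q n)) \<le> B2"
    using inverse_qpoch_bounded[OF assms(1,1)] by blast
  obtain B3 where B3: "\<And>k. norm (unit_alpha a q k) \<le> B3"
    using unit_alpha_bounded[OF assms] by blast
  define b where "b n = a ^ n * q ^ n\<^sup>2 / qpoch q q n" for n
  define d where "d k = unit_alpha a q k * a ^ (2 * k) * q ^ (2 * k\<^sup>2)" for k
  have ale: "norm (a ^ n) \<le> 1" for n
    using assms by (simp add: norm_power power_le_one)
  have b_summable: "summable (\<lambda>n. norm (b n))"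
  proof -
    have "norm (a ^ n * inverse (qpoch q q n)) \<le> 1 * B2" for n
      unfolding norm_mult using B2 ale by (intro mult_mono) auto
    then have "summable (\<lambda>n. norm (a ^ n * inverse (qpoch q q n) * q ^ n\<^sup>2))"
      by (rule summable_norm_mult_power_square[OF assms(1)])
    then show ?thesis
      by (simp add: b_def divide_inverse mult_ac)
  qed
  have d_summable: "summable (\<lambda>n. norm (d n))"
  proof -
    have "norm (unit_alpha a q k * a ^ (2 * k) * q ^ k\<^sup>2) \<le> B3 * 1 * 1" for k
      unfolding norm_mult using B3 ale assms(1) order_trans[OF norm_ge_zero B3[of k]]
      by (intro mult_mono) (auto simp: norm_power power_le_one)
    then have "summable (\<lambda>k. norm (unit_alpha a q k * a ^ (2 * k) * q ^ k\<^sup>2 * q ^ k\<^sup>2))"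
      by (rule summable_norm_mult_power_square[OF assms(1)])
    then show ?thesis
      by (simp add: d_def mult_2 power_add mult_ac)
  qed
  have finite_identity: "(\<Sum>r\<le>n. b r * inverse (qpoch q q (n - r)))
      = (\<Sum>k\<le>n. d k * (inverse (qpoch q q (n - k)) * inverse (qpoch (a * q) q (n + k))))" for n
  proof -
    have once: "(\<Sum>r\<le>m. a ^ r * q ^ r\<^sup>2 * (if r = 0 then 1 else 0) / qpoch q q (m - r))
        = 1 / qpoch q q m" for m
      by (subst sum.mono_neutral_right[of _ "{0}"]) auto
    have "bailey_pair a q (\<lambda>k. a ^ k * q ^ k\<^sup>2 * unit_alpha a q k) (\<lambda>n. 1 / qpoch q q n)"
      using bailey_lemma[OF assms unit_bailey_pair[OF assms]] unfolding once .
    from bailey_lemma[OF assms this]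
    have "(\<Sum>r\<le>n. a ^ r * q ^ r\<^sup>2 * (1 / qpoch q q r) / qpoch q q (n - r))
        = (\<Sum>k\<le>n. a ^ k * q ^ k\<^sup>2 * (a ^ k * q ^ k\<^sup>2 * unit_alpha a q k)
            / (qpoch q q (n - k) * qpoch (a * q) q (n + k)))"
      by (simp only: bailey_pair_def)
    moreover have double: "x ^ (2 * m) = x ^ m * x ^ m" for x :: complex and m
      by (simp add: mult_2 power_add)
    ultimately show ?thesis
      unfolding b_def d_def double by (simp add: divide_inverse mult_ac)
  qed
  have "(\<lambda>n. \<Sum>r\<le>n. b r * inverse (qpoch q q (n - r)))
      \<longlonglongrightarrow> (\<Sum>r. b r) * inverse (qpoch_inf q q)"
    by (rule tendsto_sum_atMost_tannery[OF b_summable _ B2(2)])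
      (intro inverse_qpoch_tendsto filterlim_minus_const_nat assms)
  moreover have "(\<lambda>n. \<Sum>k\<le>n. d k * (inverse (qpoch q q (n - k)) * inverse (qpoch (a * q) q (n + k))))
      \<longlonglongrightarrow> (\<Sum>k. d k) * (inverse (qpoch_inf q q) * inverse (qpoch_inf (a * q) q))"
  proof (rule tendsto_sum_atMost_tannery[OF d_summable])
    show "(\<lambda>n. inverse (qpoch q q (n - k)) * inverse (qpoch (a * q) q (n + k)))
        \<longlonglongrightarrow> inverse (qpoch_inf q q) * inverse (qpoch_inf (a * q) q)" for k
      by (intro tendsto_mult inverse_qpoch_tendsto filterlim_minus_const_nat assms aq)
        (rule filterlim_add_const_nat_at_top)
    show "norm (inverse (qpoch q q (n - k)) * inverse (qpoch (a * q) q (n + k))) \<le> B2 * B1" for n k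
      unfolding norm_mult using B1 B2 by (intro mult_mono) auto
  qed
  ultimately have "(\<Sum>r. b r) * inverse (qpoch_inf q q)
      = (\<Sum>k. d k) * (inverse (qpoch_inf q q) * inverse (qpoch_inf (a * q) q))"
    unfolding finite_identity by (rule LIMSEQ_unique)
  then have "(\<Sum>r. b r) = (\<Sum>k. d k) / qpoch_inf (a * q) q"
    using qpoch_inf_nonzero[OF assms(1,1)] by (simp add: divide_inverse)
  then show ?thesis
    using summable_sums[OF summable_norm_cancel[OF b_summable]] by (simp add: b_def d_def)
qed

lemma choose_two_square: "k\<^sup>2 = 2 * (k choose 2) + k"
  by (induction k) (simp_all add: Suc_choose_two power2_eq_square binomial_eq_0)

text \<open>
  Change of base from \<open>q\<close> to \<open>q\<^sup>5\<close>: two Bailey steps contribute the power \<open>2k\<^sup>2\<close>, that is, four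
  more triangular numbers \<open>k choose 2\<close> and a linear term.
\<close>

lemma signed_tri_power_5:
  "signed_tri (q ^ 5) k * (q ^ m) ^ k = signed_tri q k * q ^ (2 * k\<^sup>2) * q ^ m_shift"
  if "5 * (k choose 2) + m * k = (k choose 2) + 2 * k\<^sup>2 + m_shift"
proof -
  have "q ^ (5 * (k choose 2) + m * k) = q ^ ((k choose 2) + 2 * k\<^sup>2 + m_shift)"
    by (simp only: that)
  then show ?thesis
    by (simp add: signed_tri_def power_add power_mult mult.assoc)
qed

text \<open>
  For \<open>a = 1\<close> and \<open>k > 0\<close> the \<open>k\<close>-th coefficient contains \<open>1 + q\<^sup>k\<close>, whose two parts are the powers \<open>z\<^sup>k\<close>
  and \<open>w\<^sup>k\<close> of the triple product with \<open>z = q\<^sup>2\<close> and \<open>w = q\<^sup>3\<close>. The product side is kept as three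
  infinite products over \<open>(q; q)\<^sub>\<infinity>\<close>, the form in which it is used.
\<close>

theorem rogers_ramanujan_1:
  assumes "norm q < 1"
  shows "(\<lambda>n. q ^ n\<^sup>2 / qpoch q q n) sums (qpoch_inf_list [q\<^sup>2, q ^ 3, q ^ 5] (q ^ 5) / qpoch_inf q q)"
proof -
  define A where "A k = signed_tri (q ^ 5) k * (q\<^sup>2) ^ k" for k
  define B where "B k = signed_tri (q ^ 5) k * (q ^ 3) ^ k" for k
  have q5: "norm (q ^ 5) < 1"
    using assms by (simp add: norm_power power_less_one_iff)
  have "unit_alpha 1 q k * 1 ^ (2 * k) * q ^ (2 * k\<^sup>2) = A k + (if k = 0 then 0 else B k)" for k
  proof (cases k)
    case 0
    then show ?thesis by (simp add: unit_alpha_def A_def)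
  next
    case (Suc l)
    have "1 - q ^ k \<noteq> 0"
      using one_minus_mult_power_nonzero[OF assms assms, of l] by (simp add: Suc)
    moreover have "1 - q ^ (2 * k) = (1 - q ^ k) * (1 + q ^ k)"
      unfolding power_even_eq by algebra
    moreover have "qpoch q q k = qpoch q q (k - 1) * (1 - q ^ k)"
      by (simp add: Suc qpoch_Suc)
    ultimately have "unit_alpha 1 q k = (1 + q ^ k) * signed_tri q k"
      using Suc qpoch_self_nonzero[OF assms] by (simp add: unit_alpha_def)
    moreover have "A k = signed_tri q k * q ^ (2 * k\<^sup>2)"
      unfolding A_def using signed_tri_power_5[of k 2 0] choose_two_square[of k] by simp
    moreover have "B k = signed_tri q k * q ^ (2 * k\<^sup>2) * q ^ k"
      unfolding B_def using signed_tri_power_5[of k 3 k] choose_two_square[of k] by simp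
    ultimately show ?thesis
      using Suc by (simp add: algebra_simps)
  qed
  moreover have "(\<Sum>k. A k + (if k = 0 then 0 else B k)) = qpoch_inf_list [q\<^sup>2, q ^ 3, q ^ 5] (q ^ 5)"
  proof -
    have A: "summable A"
      unfolding A_def by (rule summable_norm_cancel[OF summable_norm_signed_tri_power[OF q5]])
    have B: "summable (\<lambda>k. B (Suc k))"
      unfolding B_def
      by (rule summable_Suc_iff[THEN iffD2,
            OF summable_norm_cancel[OF summable_norm_signed_tri_power[OF q5]]])
    \<comment> \<open>The triple product pairs \<open>A k\<close> with \<open>B (Suc k)\<close>, the series of the unit pair with \<open>B k\<close>.\<close>
    have "(\<lambda>k. if k = 0 then 0 else B k) sums (\<Sum>k. B (Suc k))"
      using summable_sums[OF B] sums_Suc_iff[of "\<lambda>k. if k = 0 then 0 else B k" "\<Sum>k. B (Suc k)"]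
      by simp
    then have "(\<lambda>k. A k + (if k = 0 then 0 else B k)) sums ((\<Sum>k. A k) + (\<Sum>k. B (Suc k)))"
      by (intro sums_add summable_sums A)
    moreover have "(\<Sum>k. A k) + (\<Sum>k. B (Suc k)) = (\<Sum>k. A k + B (Suc k))"
      by (rule suminf_add[OF A B])
    moreover have "q\<^sup>2 * q ^ 3 = q ^ 5"
      by (simp flip: power_add)
    from jacobi_triple_product[OF q5 this]
    have "(\<Sum>k. A k + B (Suc k)) = qpoch_inf_list [q\<^sup>2, q ^ 3, q ^ 5] (q ^ 5)"
      unfolding A_def B_def qpoch_inf_list_def by (simp add: sums_iff mult_ac)
    ultimately show ?thesis
      by (simp add: sums_iff)
  qed
  ultimately show ?thesis
    using rogers_ramanujan_parameter[OF assms, of 1] by simp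
qed

text \<open>
  For \<open>a = q\<close> the \<open>k\<close>-th coefficient contains \<open>1 - q^(2k+1)\<close>, whose two parts are the powers \<open>z\<^sup>k\<close>
  and \<open>w^(k+1)\<close> of the triple product with \<open>z = q\<^sup>4\<close> and \<open>w = q\<close>.
\<close>

theorem rogers_ramanujan_2:
  assumes "norm q < 1"
  shows "(\<lambda>n. q ^ (n\<^sup>2 + n) / qpoch q q n) sums (qpoch_inf_list [q, q ^ 4, q ^ 5] (q ^ 5) / qpoch_inf q q)"
proof -
  have q5: "norm (q ^ 5) < 1"
    using assms by (simp add: norm_power power_less_one_iff)
  have q1: "1 - q \<noteq> 0"
    using assms by auto
  have "unit_alpha q q k * q ^ (2 * k) * q ^ (2 * k\<^sup>2) = (signed_tri (q ^ 5) k * (q ^ 4) ^ k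
      + signed_tri (q ^ 5) (Suc k) * q ^ Suc k) / (1 - q)" for k
  proof -
    have "unit_alpha q q k = (1 - q ^ (2 * k + 1)) * signed_tri q k / (1 - q)"
    proof (cases k)
      case 0
      then show ?thesis using q1 by (simp add: unit_alpha_def)
    next
      case (Suc l)
      have "qpoch q q k = (1 - q) * qpoch (q * q) q (k - 1)"
        by (simp add: Suc qpoch_Suc_left)
      then show ?thesis
        using Suc qpoch_self_nonzero[OF assms, of k] by (simp add: unit_alpha_def)
    qed
    moreover have "signed_tri (q ^ 5) k * (q ^ 4) ^ k = signed_tri q k * q ^ (2 * k\<^sup>2) * q ^ (2 * k)"
      using signed_tri_power_5[of k 4 "2 * k"] choose_two_square[of k] by simp
    moreover have "signed_tri (q ^ 5) (Suc k) * q ^ Suc k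
        = - (signed_tri (q ^ 5) k * (q ^ 4) ^ k * q ^ (2 * k + 1))"
    proof -
      have "5 * k + Suc k = 4 * k + (2 * k + 1)"
        by simp
      then have "(q ^ 5) ^ k * q ^ Suc k = (q ^ 4) ^ k * q ^ (2 * k + 1)"
        by (metis power_add power_mult)
      moreover have "- A * S * B = - (S * D * E)" if "A * B = D * E" for A B D E S :: complex
        using that by algebra
      ultimately show ?thesis
        unfolding signed_tri_Suc by blast
    qed
    ultimately show ?thesis
      by (simp add: algebra_simps)
  qed
  moreover have "(\<lambda>k. signed_tri (q ^ 5) k * (q ^ 4) ^ k + signed_tri (q ^ 5) (Suc k) * q ^ Suc k)
      sums qpoch_inf_list [q, q ^ 4, q ^ 5] (q ^ 5)"
    using jacobi_triple_product[OF q5, of "q ^ 4" q]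
    by (simp add: qpoch_inf_list_def mult_ac flip: power_Suc)
  then have "(\<Sum>k. (signed_tri (q ^ 5) k * (q ^ 4) ^ k + signed_tri (q ^ 5) (Suc k) * q ^ Suc k) / (1 - q))
      = qpoch_inf_list [q, q ^ 4, q ^ 5] (q ^ 5) / (1 - q)"
    by (intro sums_unique[symmetric] sums_divide)
  moreover have "qpoch_inf q q = (1 - q) * qpoch_inf (q * q) q"
    using qpoch_inf_split[OF assms, of q 1] by (simp add: qpoch_Suc)
  ultimately show ?thesis
    using rogers_ramanujan_parameter[OF assms, of q] assms by (simp add: power_add mult.commute)
qed

section \<open>Reduction of the triple sum\<close>

lemma summable_on_geometric_triple:
  fixes r :: real
  assumes "0 \<le> r" "r < 1"
  shows "(\<lambda>(j, i, k). r ^ j * (r ^ i * r ^ k)) summable_on (UNIV :: (nat \<times> nat \<times> nat) set)"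
proof -
  define S where "S = 1 / (1 - r)"
  have geometric: "((\<lambda>k. r ^ k) has_sum S) UNIV"
    using assms unfolding S_def
    by (intro norm_summable_imp_has_sum geometric_sums) (simp_all add: summable_geometric)
  have summable: "(\<lambda>k. r ^ k * c) summable_on UNIV" for c
    using has_sum_cmult_left[OF geometric] by (rule has_sum_imp_summable)
  have pair: "(\<lambda>(i, k). r ^ i * r ^ k) summable_on Sigma UNIV (\<lambda>_. UNIV)"
    using assms geometric
    by (intro summable_on_SigmaI[where g = "\<lambda>i. r ^ i * S"]) (auto intro!: has_sum_cmult_right summable)
  then obtain T where "((\<lambda>(i, k). r ^ i * r ^ k) has_sum T) (UNIV :: (nat \<times> nat) set)"
    by (auto simp: summable_on_def)
  then have "((\<lambda>y. r ^ j * (case y of (i, k) \<Rightarrow> r ^ i * r ^ k)) has_sum r ^ j * T) UNIV" for j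
    by (rule has_sum_cmult_right)
  then have "(\<lambda>(j, y). r ^ j * (case y of (i, k) \<Rightarrow> r ^ i * r ^ k)) summable_on Sigma UNIV (\<lambda>_. UNIV)"
    using assms
    by (intro summable_on_SigmaI[where g = "\<lambda>i. r ^ i * T"]) (auto intro!: summable)
  then show ?thesis
    by (simp add: case_prod_unfold)
qed

text \<open>
  The terms of Euler's expansion at \<open>z = -a^(j+1)\<close>, with \<open>a = q\<close> for the index \<open>i\<close> and \<open>a = q\<^sup>2\<close> for the
  index \<open>k\<close> of the triple sum; the argument is written \<open>-a * a ^ j\<close> to match \<open>qpoch_inf_split\<close>.
\<close>

lemma signed_tri_mult_minus_power:
  "signed_tri a i * (- a * a ^ j) ^ i = a ^ ((i choose 2) + i + i * j)"
proof -
  have "- a * a ^ j = (-1) * a ^ Suc j"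
    by simp
  then have "(- a * a ^ j) ^ i = (-1) ^ i * a ^ (i + i * j)"
    by (simp only: power_mult_distrib power_mult[symmetric]) (simp add: algebra_simps)
  moreover have "(-1) ^ i * (-1) ^ i = (1 :: complex)"
    by (simp flip: power_mult_distrib)
  ultimately show ?thesis
    by (simp add: signed_tri_def power_add mult_ac)
qed

text \<open>
  The parameter \<open>e\<close> is \<open>0\<close> for the first identity and \<open>4\<close> for the second. The summation over \<open>j\<close> is
  moved outermost, and absolute convergence follows from comparison with a product of three geometric
  series, since the exponent of \<open>q\<close> is at least \<open>i + j + k\<close>.
\<close>

lemma triple_sum_eq_single_sum:
  fixes q :: complex and e :: nat
  assumes q: "norm q < 1"
    and S: "(\<lambda>j. q ^ (4 * j\<^sup>2 + e * j) / qpoch (q ^ 4) (q ^ 4) j) sums S"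
  shows "((\<lambda>(i::nat, j::nat, k::nat).
      q ^ ((i\<^sup>2 + i) div 2 + 4 * j\<^sup>2 + k\<^sup>2 + i * j + 2 * j * k + e * j + k)
      / (qpoch q q i * qpoch q q j * qpoch (q\<^sup>2) (q\<^sup>2) k))
    has_sum (qpoch_inf (q ^ 4) (q ^ 4) / qpoch_inf q q * S)) UNIV"
proof -
  have q2: "norm (q\<^sup>2) < 1" and q4: "norm (q ^ 4) < 1" and nq: "norm (- q) < 1" and nq2: "norm (- (q\<^sup>2)) < 1"
    using q by (simp_all add: norm_power power_less_one_iff)
  define X where "X j i = signed_tri q i * (- q * q ^ j) ^ i / qpoch q q i" for j i
  define Y where "Y j k = signed_tri (q\<^sup>2) k * (- (q\<^sup>2) * (q\<^sup>2) ^ j) ^ k / qpoch (q\<^sup>2) (q\<^sup>2) k" for j k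
  define c where "c j = q ^ (4 * j\<^sup>2 + e * j) / qpoch q q j" for j
  define f where "f = (\<lambda>(j, i, k). c j * (X j i * Y j k))"
  have X_eq: "X j i = q ^ ((i\<^sup>2 + i) div 2 + i * j) / qpoch q q i" for i j
  proof -
    have "(i\<^sup>2 + i) div 2 = (i choose 2) + i"
      by (simp add: choose_two_square)
    then show ?thesis
      unfolding X_def signed_tri_mult_minus_power by (simp only:)
  qed
  have Y_eq: "Y j k = q ^ (k\<^sup>2 + 2 * j * k + k) / qpoch (q\<^sup>2) (q\<^sup>2) k" for j k
  proof -
    have "2 * ((k choose 2) + k + k * j) = k\<^sup>2 + 2 * j * k + k"
      by (simp add: choose_two_square algebra_simps)
    then show ?thesis
      unfolding Y_def signed_tri_mult_minus_power
      unfolding power_mult[symmetric] by (simp only:)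
  qed
  have f_eq: "f (j, i, k) = q ^ ((i\<^sup>2 + i) div 2 + 4 * j\<^sup>2 + k\<^sup>2 + i * j + 2 * j * k + e * j + k)
      / (qpoch q q i * qpoch q q j * qpoch (q\<^sup>2) (q\<^sup>2) k)" for i j k
    unfolding f_def X_eq Y_eq c_def by (simp add: power_add mult_ac)
  have f_summable: "f summable_on UNIV"
  proof -
    obtain M where M: "M \<ge> 0" "\<And>n. norm (inverse (qpoch q q n)) \<le> M"
      using inverse_qpoch_bounded[OF q q] by blast
    obtain M2 where M2: "M2 \<ge> 0" "\<And>n. norm (inverse (qpoch (q\<^sup>2) (q\<^sup>2) n)) \<le> M2"
      using inverse_qpoch_bounded[OF q2 q2] by blast
    have bound: "norm (f y) \<le> (case y of (j, i, k) \<Rightarrow> norm q ^ j * (norm q ^ i * norm q ^ k)) * (M * M * M2)" for y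
    proof -
      obtain j i k where y: "y = (j, i, k)"
        by (cases y)
      define E where "E = (i\<^sup>2 + i) div 2 + 4 * j\<^sup>2 + k\<^sup>2 + i * j + 2 * j * k + e * j + k"
      have "i \<le> (i\<^sup>2 + i) div 2" "j \<le> j\<^sup>2"
        by (simp_all add: choose_two_square power2_eq_square)
      then have "j + (i + k) \<le> E"
        unfolding E_def by linarith
      then have "norm q ^ E \<le> norm q ^ (j + (i + k))"
        using q by (intro power_decreasing) auto
      moreover have "norm (f y) = norm q ^ E * (norm (inverse (qpoch q q i)) * norm (inverse (qpoch q q j))
          * norm (inverse (qpoch (q\<^sup>2) (q\<^sup>2) k)))"
        unfolding y f_eq E_def[symmetric]
        by (simp add: norm_mult norm_divide norm_power norm_inverse divide_inverse mult_ac)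
      moreover have "\<dots> \<le> norm q ^ (j + (i + k)) * (M * M * M2)"
        using M M2 calculation(1) by (intro mult_mono) auto
      ultimately show ?thesis
        by (simp add: y power_add)
    qed
    have majorant: "(\<lambda>y. (case y of (j, i, k) \<Rightarrow> norm q ^ j * (norm q ^ i * norm q ^ k)) * (M * M * M2))
        summable_on UNIV"
      using q by (intro summable_on_cmult_left[OF summable_on_geometric_triple]) auto
    show ?thesis
      by (rule abs_summable_summable[OF Infinite_Sum.abs_summable_on_comparison_test'[OF majorant bound]])
  qed
  have X_sum: "(X j has_sum qpoch_inf (- q * q ^ j) q) UNIV" for j
    unfolding X_def
    by (intro norm_summable_imp_has_sum summable_norm_euler euler_sums q)
  have Y_sum: "(Y j has_sum qpoch_inf (- (q\<^sup>2) * (q\<^sup>2) ^ j) (q\<^sup>2)) UNIV" for j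
    unfolding Y_def
    by (intro norm_summable_imp_has_sum summable_norm_euler euler_sums q2)
  have inner: "((\<lambda>y. f (j, y)) has_sum
      (q ^ (4 * j\<^sup>2 + e * j) / qpoch (q ^ 4) (q ^ 4) j * (qpoch_inf (q ^ 4) (q ^ 4) / qpoch_inf q q))) UNIV" for j
  proof -
    have summable: "(\<lambda>y. f (j, y)) summable_on UNIV"
      using summable_on_SigmaD1[of "\<lambda>j y. f (j, y)" UNIV "\<lambda>_. UNIV" j] f_summable by simp
    have "((\<lambda>y. f (j, y)) has_sum
      (c j * (qpoch_inf (- q * q ^ j) q * qpoch_inf (- (q\<^sup>2) * (q\<^sup>2) ^ j) (q\<^sup>2)))) (Sigma UNIV (\<lambda>_. UNIV))"
    proof (rule has_sum_SigmaI)
      show "((\<lambda>k. f (j, i, k)) has_sum (c j * (X j i * qpoch_inf (- (q\<^sup>2) * (q\<^sup>2) ^ j) (q\<^sup>2)))) UNIV" for i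
        unfolding f_def prod.case by (intro has_sum_cmult_right Y_sum)
      show "((\<lambda>i. c j * (X j i * qpoch_inf (- (q\<^sup>2) * (q\<^sup>2) ^ j) (q\<^sup>2))) has_sum
        (c j * (qpoch_inf (- q * q ^ j) q * qpoch_inf (- (q\<^sup>2) * (q\<^sup>2) ^ j) (q\<^sup>2)))) UNIV"
        by (intro has_sum_cmult_right has_sum_cmult_left X_sum)
    qed (use summable in simp)
    moreover have "c j * (qpoch_inf (- q * q ^ j) q * qpoch_inf (- (q\<^sup>2) * (q\<^sup>2) ^ j) (q\<^sup>2))
      = q ^ (4 * j\<^sup>2 + e * j) / qpoch (q ^ 4) (q ^ 4) j * (qpoch_inf (q ^ 4) (q ^ 4) / qpoch_inf q q)"
    proof -
      note split = qpoch_inf_split[OF q, of "- q" j] qpoch_inf_split[OF q2, of "- (q\<^sup>2)" j]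
      have "qpoch_inf q q * qpoch_inf (- q) q * qpoch_inf (- (q\<^sup>2)) (q\<^sup>2) = qpoch_inf (q ^ 4) (q ^ 4)"
        using qpoch_inf_mult_neg[OF q, of q] qpoch_inf_mult_neg[OF q2, of "q\<^sup>2"] by simp
      then have merged: "qpoch_inf (q ^ 4) (q ^ 4) / qpoch_inf q q
          = qpoch (- q) q j * qpoch_inf (- q * q ^ j) q
            * (qpoch (- (q\<^sup>2)) (q\<^sup>2) j * qpoch_inf (- (q\<^sup>2) * (q\<^sup>2) ^ j) (q\<^sup>2))"
        unfolding split[symmetric] using qpoch_inf_nonzero[OF q q] by (simp add: field_simps)
      have denominator: "qpoch (q ^ 4) (q ^ 4) j = qpoch q q j * qpoch (- q) q j * qpoch (- (q\<^sup>2)) (q\<^sup>2) j"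
        using qpoch_mult_neg[of q q j] qpoch_mult_neg[of "q\<^sup>2" "q\<^sup>2" j] by simp
      show ?thesis
        unfolding c_def merged denominator
        using qpoch_nonzero[OF nq q, of j] qpoch_nonzero[OF nq2 q2, of j] by simp
    qed
    ultimately show ?thesis
      by simp
  qed
  have outer: "((\<lambda>j. q ^ (4 * j\<^sup>2 + e * j) / qpoch (q ^ 4) (q ^ 4) j
      * (qpoch_inf (q ^ 4) (q ^ 4) / qpoch_inf q q)) has_sum
      (S * (qpoch_inf (q ^ 4) (q ^ 4) / qpoch_inf q q))) UNIV"
  proof (intro has_sum_cmult_left norm_summable_imp_has_sum S)
    obtain M where M: "M \<ge> 0" "\<And>n. norm (inverse (qpoch (q ^ 4) (q ^ 4) n)) \<le> M"
      using inverse_qpoch_bounded[OF q4 q4] by blast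
    have "norm (q ^ (e * j) * inverse (qpoch (q ^ 4) (q ^ 4) j)) \<le> 1 * M" for j
      unfolding norm_mult norm_power using M q by (intro mult_mono power_le_one) auto
    then have "summable (\<lambda>j. norm (q ^ (e * j) * inverse (qpoch (q ^ 4) (q ^ 4) j) * (q ^ 4) ^ j\<^sup>2))"
      by (rule summable_norm_mult_power_square[OF q4])
    then show "summable (\<lambda>j. norm (q ^ (4 * j\<^sup>2 + e * j) / qpoch (q ^ 4) (q ^ 4) j))"
      by (simp add: power_add power_mult divide_inverse mult_ac)
  qed
  have "(f has_sum (S * (qpoch_inf (q ^ 4) (q ^ 4) / qpoch_inf q q))) (Sigma UNIV (\<lambda>_. UNIV))"
    by (rule has_sum_SigmaI[OF inner outer]) (use f_summable in simp)
  then have "(f has_sum (qpoch_inf (q ^ 4) (q ^ 4) / qpoch_inf q q * S)) UNIV"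
    by (simp add: mult.commute)
  then show ?thesis
    by (rule has_sum_reindex_bij_witness[of _ "\<lambda>(i, j, k). (j, i, k)" "\<lambda>(j, i, k). (i, j, k)", THEN iffD1, rotated -1])
      (auto simp: f_eq)
qed

theorem theorem3p3:
  fixes q :: complex
  assumes "norm q < 1"
  shows "((\<lambda>(i::nat, j::nat, k::nat).
             q ^ ((i\<^sup>2 + i) div 2 + 4 * j\<^sup>2 + k\<^sup>2 + i * j + 2 * j * k + k)
             / (qpoch q q i * qpoch q q j * qpoch (q\<^sup>2) (q\<^sup>2) k))
           has_sum (qpoch_inf_list [q ^ 8, q ^ 12, q ^ 20] (q ^ 20) / qpoch_inf q q)) UNIV
       \<and> ((\<lambda>(i::nat, j::nat, k::nat).
             q ^ ((i\<^sup>2 + i) div 2 + 4 * j\<^sup>2 + k\<^sup>2 + i * j + 2 * j * k + 4 * j + k)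
             / (qpoch q q i * qpoch q q j * qpoch (q\<^sup>2) (q\<^sup>2) k))
           has_sum (qpoch_inf_list [q ^ 4, q ^ 16, q ^ 20] (q ^ 20) / qpoch_inf q q)) UNIV"
proof
  have q4: "norm (q ^ 4) < 1"
    using assms by (simp add: norm_power power_less_one_iff)
  note nz = qpoch_inf_nonzero[OF q4 q4]
  have "(\<lambda>j. q ^ (4 * j\<^sup>2 + 0 * j) / qpoch (q ^ 4) (q ^ 4) j) sums
      (qpoch_inf_list [q ^ 8, q ^ 12, q ^ 20] (q ^ 20) / qpoch_inf (q ^ 4) (q ^ 4))"
    using rogers_ramanujan_1[OF q4] by (simp flip: power_mult)
  from triple_sum_eq_single_sum[OF assms this]
  show "((\<lambda>(i::nat, j::nat, k::nat).
             q ^ ((i\<^sup>2 + i) div 2 + 4 * j\<^sup>2 + k\<^sup>2 + i * j + 2 * j * k + k)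
             / (qpoch q q i * qpoch q q j * qpoch (q\<^sup>2) (q\<^sup>2) k))
           has_sum (qpoch_inf_list [q ^ 8, q ^ 12, q ^ 20] (q ^ 20) / qpoch_inf q q)) UNIV"
    using nz by simp
  have "(\<lambda>j. q ^ (4 * j\<^sup>2 + 4 * j) / qpoch (q ^ 4) (q ^ 4) j) sums
      (qpoch_inf_list [q ^ 4, q ^ 16, q ^ 20] (q ^ 20) / qpoch_inf (q ^ 4) (q ^ 4))"
    using rogers_ramanujan_2[OF q4] by (simp add: distrib_left flip: power_mult)
  from triple_sum_eq_single_sum[OF assms this]
  show "((\<lambda>(i::nat, j::nat, k::nat).
             q ^ ((i\<^sup>2 + i) div 2 + 4 * j\<^sup>2 + k\<^sup>2 + i * j + 2 * j * k + 4 * j + k)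
             / (qpoch q q i * qpoch q q j * qpoch (q\<^sup>2) (q\<^sup>2) k))
           has_sum (qpoch_inf_list [q ^ 4, q ^ 16, q ^ 20] (q ^ 20) / qpoch_inf q q)) UNIV"
    using nz by simp
qed

end
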